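(* For any two integers $q,h>0$ and all sufficiently large $n$, there exist an unweighted undirected $n$-node graph $G=(V,E)$ and a pair $s,t\in V$ such that every $2hq$-FT $(2q-1)$-additive spanner for $G$ for the single pair $(s,t)$ has $\Omega\left(\left(\frac{n}{hq}\right)^{2-2/(h+1)}\right)$ edges.
   Context: For a graph $G=(V,E)$ and $P\subseteq V\times V$, a subgraph $H\subseteq G$ is an $f$-FT $\beta$-additive $P$-pairwise spanner if $\mathrm{dist}_{H\setminus F}(s,t)\leq \mathrm{dist}_{G\setminus F}(s,t)+\beta$ for all $(s,t)\in P$ and all $F\subseteq E$ with $|F|\leq f$. A spanner for the single pair $(s,t)$ means $P=\{(s,t)\}$. *)

theory Defs
  imports Complex_Main "HOL-Library.Extended_Nat"
begin

record 'a ugraph =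
  verts :: "'a set"
  edges :: "'a set set"

definition fin_ugraph :: "'a ugraph \<Rightarrow> bool" where
  "fin_ugraph G \<longleftrightarrow> finite (verts G) \<and> (\<forall>e\<in>edges G. e \<subseteq> verts G \<and> card e = 2)"

definition subgraph :: "'a ugraph \<Rightarrow> 'a ugraph \<Rightarrow> bool" where
  "subgraph H G \<longleftrightarrow> fin_ugraph H \<and> verts H \<subseteq> verts G \<and> edges H \<subseteq> edges G"

text \<open>The faults \<open>F\<close> are edges of the ambient graph and need not belong to the graph they are
  deleted from; all vertices are kept.\<close>

definition del_edges :: "'a ugraph \<Rightarrow> 'a set set \<Rightarrow> 'a ugraph" where
  "del_edges G F = \<lparr>verts = verts G, edges = edges G - F\<rparr>"

definition walk_betw :: "'a ugraph \<Rightarrow> 'a \<Rightarrow> 'a list \<Rightarrow> 'a \<Rightarrow> bool" where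
  "walk_betw G u p v \<longleftrightarrow>
     p \<noteq> [] \<and> hd p = u \<and> last p = v \<and> set p \<subseteq> verts G \<and>
     successively (\<lambda>x y. {x, y} \<in> edges G) p"

text \<open>Walks are lists of vertices, so a walk \<open>p\<close> has \<open>length p - 1\<close> edges. The distance between
  vertices in different components is \<open>\<infinity>\<close>, the infimum of the empty set.\<close>

definition gdist :: "'a ugraph \<Rightarrow> 'a \<Rightarrow> 'a \<Rightarrow> enat" where
  "gdist G u v = (INF p \<in> {p. walk_betw G u p v}. enat (length p - 1))"

definition ft_additive_pairwise_spanner ::
  "nat \<Rightarrow> nat \<Rightarrow> ('a \<times> 'a) set \<Rightarrow> 'a ugraph \<Rightarrow> 'a ugraph \<Rightarrow> bool" where
  "ft_additive_pairwise_spanner f \<beta> P G H \<longleftrightarrow>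
     subgraph H G \<and>
     (\<forall>(s, t) \<in> P. \<forall>F. F \<subseteq> edges G \<and> card F \<le> f \<longrightarrow>
        gdist (del_edges H F) s t \<le> gdist (del_edges G F) s t + enat \<beta>)"

end

theory Submission imports Defs "HOL-Library.Countable" begin

text \<open>
  Take a rooted tree with \<open>k ^ h\<close> leaves in which leaf \<open>j\<close> has depth \<open>const - 2 * j\<close>, and in which
  removing \<open>h\<close> edges disconnects exactly the leaves after \<open>j\<close> from the root; leaf \<open>j\<close> is then the
  nearest remaining leaf, by a margin of 2. Join the leaves of two such trees by a complete
  bipartite graph. Once \<open>2 * h\<close> faults have singled out a leaf on either side, a root-to-root walk
  that avoids the edge between these two leaves is longer by at least 2. Chaining \<open>q\<close> copies in
  series, a subgraph that misses a bipartite edge in every copy has additive error at least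
  \<open>2 * q\<close>, so a spanner contains all \<open>k ^ (2 * h)\<close> bipartite edges of some copy. The graph needs only
  \<open>O(q * h * k ^ (h + 1))\<close> vertices. The lower bound on the faulty distance is witnessed by an
  integer potential that changes by at most 1 along each edge.
\<close>

section \<open>Distance bounds from walks and from potentials\<close>

lemma gdist_le_of_reach:
  fixes f :: "'b \<Rightarrow> 'a" and \<psi> :: "'b \<Rightarrow> int"
  assumes "R\<^sup>*\<^sup>* u v" and u: "f u \<in> verts G"
    and R: "\<And>x y. R x y \<Longrightarrow> {f x, f y} \<in> edges G \<and> f y \<in> verts G \<and> \<psi> y = \<psi> x + 1"
  shows "\<psi> u \<le> \<psi> v \<and> gdist G (f u) (f v) \<le> enat (nat (\<psi> v - \<psi> u))"
proof -
  \<comment> \<open>Since \<open>\<psi>\<close> rises by exactly 1 per step, its increase counts the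
    edges of the walk.\<close>
  from assms(1) have "\<exists>p. walk_betw G (f u) p (f v) \<and> int (length p) = \<psi> v - \<psi> u + 1"
  proof (induction rule: rtranclp_induct)
    case base
    show ?case by (rule exI[of _ "[f u]"]) (use u in \<open>simp add: walk_betw_def\<close>)
  next
    case (step y z)
    then obtain p where "walk_betw G (f u) p (f y)" "int (length p) = \<psi> y - \<psi> u + 1" by blast
    then show ?case
      by (intro exI[of _ "p @ [f z]"])
        (use R[OF step(2)] in \<open>auto simp: walk_betw_def successively_append_iff\<close>)
  qed
  then obtain p where p: "walk_betw G (f u) p (f v)" "int (length p) = \<psi> v - \<psi> u + 1" by blast
  then have "p \<noteq> []" by (simp add: walk_betw_def)
  then have "length p \<ge> 1" by (cases p) auto
  with p(2) have "length p - 1 = nat (\<psi> v - \<psi> u)" "\<psi> u \<le> \<psi> v" by linarith+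
  moreover have "gdist G (f u) (f v) \<le> enat (length p - 1)"
    unfolding gdist_def by (rule INF_lower) (use p in simp)
  ultimately show ?thesis by simp
qed

lemma gdist_ge_of_potential:
  fixes \<phi> :: "'a \<Rightarrow> int"
  assumes lip: "\<And>x y. {x, y} \<in> edges G \<Longrightarrow> \<bar>\<phi> y - \<phi> x\<bar> \<le> 1"
  shows "enat (nat (\<phi> v - \<phi> u)) \<le> gdist G u v"
  unfolding gdist_def
proof (rule INF_greatest)
  fix p assume "p \<in> {p. walk_betw G u p v}"
  then have p: "p \<noteq> []" "hd p = u" "last p = v" "successively (\<lambda>x y. {x, y} \<in> edges G) p"
    by (auto simp: walk_betw_def)
  have "\<phi> (last p) - \<phi> (hd p) \<le> int (length p - 1)"
    using p(1,4)
  proof (induction p rule: rev_induct)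
    case (snoc x xs)
    show ?case
    proof (cases "xs = []")
      case False
      with snoc.prems have "successively (\<lambda>x y. {x, y} \<in> edges G) xs" "{last xs, x} \<in> edges G"
        by (auto simp: successively_append_iff)
      moreover have "length xs \<ge> 1" using False by (cases xs) auto
      ultimately show ?thesis using snoc.IH False lip[of "last xs" x] by auto
    qed simp
  qed simp
  then show "enat (nat (\<phi> v - \<phi> u)) \<le> enat (length p - 1)" using p by auto
qed

section \<open>A tree whose leaves can be singled out by \<open>h\<close> faults\<close>

locale comb_tree =
  fixes h k :: nat
  assumes h_pos: "0 < h" and k_pos: "0 < k"
begin

text \<open>The vertex \<open>(m, c, a)\<close> has height \<open>m\<close> and lies on the way to the leaves \<open>j\<close> with
  \<open>j div k ^ m = c\<close>, at position \<open>a\<close> of a path of length \<open>plen m c\<close>. The vertices \<open>(m, c, 0)\<close> with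
  \<open>c div k\<close> fixed form a spine; the path hanging off \<open>(m, c, 0)\<close> leads to the spine one level below.
  Leaf \<open>j\<close> is separated from all later ones by removing one spine edge per level.\<close>

definition plen :: "nat \<Rightarrow> nat \<Rightarrow> nat" where
  "plen m c = (k - c mod k) * (2 * k ^ m + 1)"

inductive arc :: "nat \<times> nat \<times> nat \<Rightarrow> nat \<times> nat \<times> nat \<Rightarrow> bool" where
  path: "m < h \<Longrightarrow> c < k ^ (h - m) \<Longrightarrow> a < plen m c \<Longrightarrow> arc (m, c, a) (m, c, Suc a)"
| spine: "m < h \<Longrightarrow> Suc c < k ^ (h - m) \<Longrightarrow> Suc c mod k \<noteq> 0 \<Longrightarrow> arc (m, c, 0) (m, Suc c, 0)"
| down: "Suc m < h \<Longrightarrow> c < k ^ (h - Suc m) \<Longrightarrow>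
    arc (Suc m, c, plen (Suc m) c) (m, c * k, 0)"

definition root :: "nat \<times> nat \<times> nat" where
  "root = (h - 1, 0, 0)"

definition leaf :: "nat \<Rightarrow> nat \<times> nat \<times> nat" where
  "leaf j = (0, j, plen 0 j)"

text \<open>Bounding the position by \<open>4 * k ^ Suc m\<close> instead of \<open>plen m c\<close> makes the vertex count exact;
  the superfluous vertices are isolated.\<close>

definition box :: "(nat \<times> nat \<times> nat) set" where
  "box = (SIGMA m:{..<h}. {..<k ^ (h - m)} \<times> {..<4 * k ^ Suc m})"

text \<open>Each level passed costs its longest path and one \<open>down\<close> edge. At
  \<open>m = 0\<close> that edge is fictitious, whence the \<open>- 1\<close> in
  \<open>depth_leaf\<close>.\<close>

definition top_depth :: "nat \<Rightarrow> nat" where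
  "top_depth m = (\<Sum>i=m..<h. k * (2 * k ^ i + 1) + 1)"

text \<open>Closed form of the distance from \<open>root\<close> in the tree. Each spine on level
  \<open>m\<close> starts nearer than its predecessor, by 2 for each of the \<open>k ^ Suc m\<close>
  leaves below it.\<close>

fun depth :: "nat \<times> nat \<times> nat \<Rightarrow> int" where
  "depth (m, c, a) =
    int (top_depth (Suc m)) - 2 * int k ^ Suc m * int (c div k) + int (c mod k) + int a"

text \<open>Leaf \<open>j\<close> lies below index \<open>j div k ^ m\<close> of level
  \<open>m\<close>. The kept tree vertices are those still joined to \<open>root\<close> after the
  cut.\<close>

fun kept :: "nat \<Rightarrow> nat \<times> nat \<times> nat \<Rightarrow> bool" where
  "kept j (m, c, a) \<longleftrightarrow> c \<le> j div k ^ m"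

text \<open>If \<open>Suc (j div k ^ m)\<close> begins a new spine, the pair is no arc and level
  \<open>m\<close> needs no fault.\<close>

definition cut :: "nat \<Rightarrow> nat \<times> nat \<times> nat \<Rightarrow> nat \<times> nat \<times> nat \<Rightarrow> bool" where
  "cut j u v \<longleftrightarrow> (\<exists>m<h. u = (m, j div k ^ m, 0) \<and> v = (m, Suc (j div k ^ m), 0))"

text \<open>Kept leaves other than \<open>j\<close> are at least 2 deeper than leaf
  \<open>j\<close>, so the cap gives all leaves but \<open>j\<close> the same value.\<close>

definition profile :: "nat \<Rightarrow> nat \<times> nat \<times> nat \<Rightarrow> int" where
  "profile j v =
    (if kept j v then min (depth v) (depth (leaf j) + 2) else depth (leaf j) + 2)"

lemma card_box: "card box = 4 * h * k ^ Suc h"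
proof -
  have "card box = (\<Sum>m<h. k ^ (h - m) * (4 * k ^ Suc m))"
    unfolding box_def by (subst card_SigmaI) (auto simp: card_cartesian_product)
  also have "\<dots> = (\<Sum>m<h. 4 * k ^ Suc h)"
  proof (rule sum.cong)
    fix m assume "m \<in> {..<h}"
    then have "k ^ (h - m) * k ^ Suc m = k ^ Suc h" by (simp flip: power_add)
    then show "k ^ (h - m) * (4 * k ^ Suc m) = 4 * k ^ Suc h" by (simp add: mult_ac)
  qed simp
  finally show ?thesis by simp
qed

lemma finite_box: "finite box"
  unfolding box_def by auto

lemma plen_less: "plen m c < 4 * k ^ Suc m"
proof -
  have "plen m c \<le> k * (2 * k ^ m + 1)" unfolding plen_def by (intro mult_right_mono) auto
  also have "\<dots> \<le> k * (3 * k ^ m)" using k_pos by (intro mult_left_mono) (auto simp: Suc_le_eq)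
  also have "\<dots> < 4 * k ^ Suc m" using k_pos by simp
  finally show ?thesis .
qed

lemma root_in_box: "root \<in> box"
  using h_pos k_pos by (auto simp: root_def box_def)

lemma leaf_in_box: "j < k ^ h \<Longrightarrow> leaf j \<in> box"
  using h_pos plen_less[of 0 j] by (auto simp: leaf_def box_def)

lemma arc_in_box: "arc u v \<Longrightarrow> u \<in> box \<and> v \<in> box"
proof (induction rule: arc.induct)
  case (path m c a)
  then show ?case using plen_less[of m c] by (auto simp: box_def)
next
  case (spine m c)
  then show ?case using k_pos by (auto simp: box_def)
next
  case (down m c)
  then have "c * k < k ^ (h - Suc m) * k" using k_pos by simp
  also have "\<dots> = k ^ (h - m)" using down by (simp flip: power_Suc2 add: Suc_diff_Suc)
  finally show ?case using down k_pos plen_less[of "Suc m" c] by (auto simp: box_def)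
qed

lemma top_depth_step: "m < h \<Longrightarrow> top_depth m = k * (2 * k ^ m + 1) + 1 + top_depth (Suc m)"
  unfolding top_depth_def by (simp add: sum.atLeast_Suc_lessThan)

text \<open>\<open>plen\<close> drops by \<open>2 * k ^ m + 1\<close> per spine step: 1 pays for the
  spine edge, the rest is 2 for each of the \<open>k ^ m\<close> leaves below.\<close>

lemma depth_end:
  assumes "m < h"
  shows "depth (m, c, plen m c) = int (top_depth m) - 1 - 2 * int k ^ m * int c"
proof -
  have "c mod k < k" using k_pos by simp
  then have "int (plen m c) = (int k - int (c mod k)) * (2 * int k ^ m + 1)"
    unfolding plen_def of_nat_mult using of_nat_diff[of "c mod k" k] by (simp add: less_imp_le)
  moreover have "int c = int k * int (c div k) + int (c mod k)"
    by (metis mult_div_mod_eq of_nat_add of_nat_mult)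
  then have "2 * int k ^ m * int c = 2 * int k ^ m * (int k * int (c div k) + int (c mod k))"
    by simp
  ultimately show ?thesis by (simp add: top_depth_step[OF assms] algebra_simps)
qed

lemma depth_leaf: "depth (leaf j) = int (top_depth 0) - 1 - 2 * int j"
  unfolding leaf_def using depth_end[OF h_pos] by simp

lemma depth_root: "depth root = 0"
  using h_pos by (simp add: root_def top_depth_def)

lemma depth_arc: "arc u v \<Longrightarrow> depth v = depth u + 1"
proof (induction rule: arc.induct)
  case (spine m c)
  then show ?case by (simp add: mod_Suc div_Suc split: if_splits)
next
  case (down m c)
  then show ?case using depth_end[of "Suc m" c] k_pos by simp
qed simp

text \<open>A spine arc leaves the kept part only at the cut; a \<open>down\<close> arc never does,
  as division by \<open>k\<close> is adjoint to multiplication.\<close>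

lemma kept_arc:
  assumes "arc u v" "\<not> cut j u v"
  shows "kept j u \<longleftrightarrow> kept j v"
  using assms
proof (induction rule: arc.induct)
  case (spine m c)
  then show ?case by (auto simp: cut_def)
next
  case (down m c)
  have "c \<le> (j div k ^ m) div k \<longleftrightarrow> c * k \<le> j div k ^ m"
    using k_pos by (simp add: less_eq_div_iff_mult_less_eq)
  then show ?case by (simp add: div_mult2_eq[symmetric] mult.commute)
qed simp

text \<open>Faults are unordered edges, so avoiding them means that neither orientation is a cut
  arc.\<close>

lemma arc_not_cut_converse: "arc u v \<Longrightarrow> \<not> cut j v u"
  by (induction rule: arc.induct) (auto simp: cut_def)

lemma kept_root: "kept j root"
  by (simp add: root_def)

lemma kept_leaf: "kept j (leaf a) \<longleftrightarrow> a \<le> j"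
  by (simp add: leaf_def)

text \<open>The route reads the base-\<open>k\<close> digits of \<open>j\<close> from the top: on
  each level it moves along the spine by one digit and takes the path hanging there, stopping short
  of the cut edge.\<close>

lemma reach_leaf:
  assumes j: "j < k ^ h"
  shows "(\<lambda>u v. arc u v \<and> \<not> cut j u v)\<^sup>*\<^sup>* root (leaf j)"
proof -
  let ?R = "\<lambda>u v. arc u v \<and> \<not> cut j u v"
  have bound: "j div k ^ m < k ^ (h - m)" if "m < h" for m
    using j that k_pos by (simp add: div_less_iff_less_mult flip: power_add)
  have along_spine: "?R\<^sup>*\<^sup>* (m, j div k ^ Suc m * k, 0) (m, j div k ^ Suc m * k + i, 0)"
    if "m < h" "i \<le> j div k ^ m mod k" for m i
    using that(2)
  proof (induction i)
    case (Suc i)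
    let ?c = "j div k ^ Suc m * k + i"
    have "j div k ^ Suc m * k + j div k ^ m mod k = j div k ^ m"
      by (metis div_mult2_eq div_mult_mod_eq power_Suc2)
    with Suc.prems have less: "?c < j div k ^ m" by linarith
    have "Suc i < k" using Suc.prems k_pos by (meson le_less_trans mod_less_divisor)
    then have "Suc ?c mod k \<noteq> 0" by (simp flip: add_Suc_right)
    then have "?R (m, ?c, 0) (m, Suc ?c, 0)"
      using spine[of m ?c] less bound[OF that(1)] that(1) by (auto simp: cut_def)
    with Suc show ?case by (auto intro: rtranclp.rtrancl_into_rtrancl)
  qed simp
  have along_path: "?R\<^sup>*\<^sup>* (m, c, 0) (m, c, a)"
    if "m < h" "c < k ^ (h - m)" "a \<le> plen m c" for m c a
    using that(3)
  proof (induction a)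
    case (Suc a)
    then have "?R (m, c, a) (m, c, Suc a)" using path[of m c a] that by (auto simp: cut_def)
    with Suc show ?case by (auto intro: rtranclp.rtrancl_into_rtrancl)
  qed simp
  have through: "?R\<^sup>*\<^sup>* (m, j div k ^ Suc m * k, 0) (m, j div k ^ m, plen m (j div k ^ m))"
    if "m < h" for m
  proof -
    have "j div k ^ Suc m * k + j div k ^ m mod k = j div k ^ m"
      by (metis div_mult2_eq div_mult_mod_eq power_Suc2)
    with along_spine[OF that order.refl]
    have "?R\<^sup>*\<^sup>* (m, j div k ^ Suc m * k, 0) (m, j div k ^ m, 0)" by (simp only:)
    from rtranclp_trans[OF this along_path[OF that bound[OF that] order.refl]] show ?thesis .
  qed
  have "?R\<^sup>*\<^sup>* root (m, j div k ^ Suc m * k, 0)" if "m \<le> h - 1" for m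
    using that
  proof (induction rule: inc_induct)
    case base
    then show ?case using h_pos j by (simp add: root_def)
  next
    case (step m)
    then have m: "Suc m < h" by simp
    have "?R (Suc m, j div k ^ Suc m, plen (Suc m) (j div k ^ Suc m)) (m, j div k ^ Suc m * k, 0)"
      using down[OF m bound[OF m]] by (auto simp: cut_def)
    from rtranclp.rtrancl_into_rtrancl[of ?R, OF rtranclp_trans[of ?R, OF step.IH through[OF m]] this]
    show ?case .
  qed
  from rtranclp_trans[OF this[of 0] through[OF h_pos]] show ?thesis
    by (simp add: leaf_def)
qed

text \<open>Depth grows from 0 along the route to leaf \<open>j\<close>. Hence the cap in
  \<open>profile\<close> does not affect \<open>root\<close>.\<close>

lemma depth_leaf_nonneg:
  assumes "j < k ^ h"
  shows "0 \<le> depth (leaf j)"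
proof -
  have "depth root \<le> depth v" if "(\<lambda>u v. arc u v \<and> \<not> cut j u v)\<^sup>*\<^sup>* root v" for v
    using that by (induction rule: rtranclp_induct) (auto dest: depth_arc)
  with reach_leaf[OF assms] show ?thesis by (auto simp: depth_root)
qed

lemma profile_root: "j < k ^ h \<Longrightarrow> profile j root = 0"
  using depth_leaf_nonneg[of j] by (simp add: profile_def kept_root depth_root)

lemma profile_leaf: "profile j (leaf a) = depth (leaf j) + (if a = j then 0 else 2)"
  by (auto simp: profile_def kept_leaf depth_leaf)

text \<open>Both ends lie on the same side of the cut, and truncation by \<open>min\<close> does not
  enlarge differences.\<close>

lemma profile_arc: "arc u v \<Longrightarrow> \<not> cut j u v \<Longrightarrow> \<bar>profile j v - profile j u\<bar> \<le> 1"
  using kept_arc[of u v j] depth_arc[of u v] by (auto simp: profile_def)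

end

section \<open>Copies in series: faults, short walk and potential\<close>

type_synonym vertex = "nat \<times> bool \<times> nat \<times> nat \<times> nat"

locale chain = comb_tree +
  fixes q :: nat
  assumes q_pos: "0 < q"
begin

text \<open>Right trees are reversed so that all arcs point from \<open>source\<close> towards
  \<open>sink\<close>.\<close>

inductive chain_arc :: "vertex \<Rightarrow> vertex \<Rightarrow> bool" where
  left: "i < q \<Longrightarrow> arc u v \<Longrightarrow> chain_arc (i, False, u) (i, False, v)"
| right: "i < q \<Longrightarrow> arc u v \<Longrightarrow> chain_arc (i, True, v) (i, True, u)"
| cross: "i < q \<Longrightarrow> a < k ^ h \<Longrightarrow> b < k ^ h \<Longrightarrow> chain_arc (i, False, leaf a) (i, True, leaf b)"
| link: "Suc i < q \<Longrightarrow> chain_arc (i, True, root) (Suc i, False, root)"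

definition chain_box :: "vertex set" where
  "chain_box = {..<q} \<times> UNIV \<times> box"

definition source :: vertex where "source = (0, False, root)"
definition sink :: vertex where "sink = (q - 1, True, root)"

definition chain_edges :: "nat set set" where
  "chain_edges = {{to_nat u, to_nat v} | u v. chain_arc u v}"

text \<open>The vertex set is a parameter to allow padding by isolated vertices.\<close>

definition chain_graph :: "nat set \<Rightarrow> nat ugraph" where
  "chain_graph W = \<lparr>verts = W, edges = chain_edges\<rparr>"

definition cross_edge :: "nat \<Rightarrow> nat \<Rightarrow> nat \<Rightarrow> nat set" where
  "cross_edge i a b = {to_nat (i, False, leaf a), to_nat (i, True, leaf b)}"

text \<open>In copy \<open>i\<close> the faults single out leaf \<open>J i False\<close> of the left and leaf \<open>J i True\<close> of the
  right tree.\<close>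

definition faults :: "(nat \<Rightarrow> bool \<Rightarrow> nat) \<Rightarrow> nat set set" where
  "faults J = {{to_nat (i, \<sigma>, u), to_nat (i, \<sigma>, v)} | i \<sigma> u v. i < q \<and> arc u v \<and> cut (J i \<sigma>) u v}"

text \<open>A copy contributes \<open>D + D' + 1\<close> to the distance if the edge between the selected leaves, of
  depths \<open>D\<close> and \<open>D'\<close>, is present, and \<open>D + D' + 3\<close> otherwise; the link to the next copy adds 1.
  This gives the increments \<open>d = 2\<close> (\<open>position\<close>) and \<open>d = 4\<close> (\<open>potential\<close>).\<close>

definition offset :: "(nat \<Rightarrow> bool \<Rightarrow> nat) \<Rightarrow> int \<Rightarrow> nat \<Rightarrow> int" where
  "offset J d i = (\<Sum>i'<i. depth (leaf (J i' False)) + depth (leaf (J i' True)) + d)"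

fun position :: "(nat \<Rightarrow> bool \<Rightarrow> nat) \<Rightarrow> vertex \<Rightarrow> int" where
  "position J (i, False, v) = offset J 2 i + depth v"
| "position J (i, True, v) =
    offset J 2 i + depth (leaf (J i False)) + 1 + depth (leaf (J i True)) - depth v"

fun potential :: "(nat \<Rightarrow> bool \<Rightarrow> nat) \<Rightarrow> vertex \<Rightarrow> int" where
  "potential J (i, False, v) = offset J 4 i + profile (J i False) v"
| "potential J (i, True, v) = offset J 4 i + depth (leaf (J i False)) + 3
    + depth (leaf (J i True)) - profile (J i True) v"

lemma card_chain_box: "card chain_box = 8 * q * h * k ^ Suc h"
  by (simp add: chain_box_def card_cartesian_product card_box mult_ac)

lemma finite_chain_box: "finite chain_box"
  by (simp add: chain_box_def finite_box)

lemma chain_arc_in_box: "chain_arc u v \<Longrightarrow> u \<in> chain_box \<and> v \<in> chain_box"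
  by (induction rule: chain_arc.induct)
    (auto simp: chain_box_def leaf_in_box root_in_box dest: arc_in_box)

lemma source_in_box: "source \<in> chain_box" and sink_in_box: "sink \<in> chain_box"
  using q_pos by (auto simp: source_def sink_def chain_box_def root_in_box)

lemma chain_arc_neq: "chain_arc u v \<Longrightarrow> u \<noteq> v"
  by (induction rule: chain_arc.induct) (auto dest: depth_arc)

lemma fin_ugraph_chain_graph:
  assumes "finite W" "to_nat ` chain_box \<subseteq> W"
  shows "fin_ugraph (chain_graph W)"
proof -
  have "e \<subseteq> W \<and> card e = 2" if "e \<in> chain_edges" for e
  proof -
    from that obtain u v where e: "e = {to_nat u, to_nat v}" "chain_arc u v"
      unfolding chain_edges_def by blast
    then have "u \<in> chain_box" "v \<in> chain_box" "to_nat u \<noteq> to_nat v"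
      using chain_arc_in_box[of u v] chain_arc_neq[of u v] by simp_all
    with e assms(2) show ?thesis by auto
  qed
  with assms(1) show ?thesis by (simp add: fin_ugraph_def chain_graph_def)
qed

lemma faults_subset: "faults J \<subseteq> chain_edges"
proof
  fix e assume "e \<in> faults J"
  then obtain i u v and \<sigma> :: bool where e: "e = {to_nat (i, \<sigma>, u), to_nat (i, \<sigma>, v)}" "i < q" "arc u v"
    unfolding faults_def by blast
  then have "chain_arc (i, \<sigma>, u) (i, \<sigma>, v) \<or> chain_arc (i, \<sigma>, v) (i, \<sigma>, u)"
    using left right by (cases \<sigma>) auto
  then show "e \<in> chain_edges" unfolding chain_edges_def e(1) by blast
qed

text \<open>There is one candidate edge per level in each of the \<open>2 * q\<close> trees.\<close>

lemma card_faults: "card (faults J) \<le> 2 * h * q"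
proof -
  let ?f = "\<lambda>(i, \<sigma>, m). {to_nat (i, \<sigma>, m, J i \<sigma> div k ^ m, 0::nat),
    to_nat (i, \<sigma>, m, Suc (J i \<sigma> div k ^ m), 0::nat)}"
  let ?S = "{..<q} \<times> (UNIV :: bool set) \<times> {..<h}"
  have "faults J \<subseteq> ?f ` ?S"
    by (force simp: faults_def cut_def)
  then have "card (faults J) \<le> card ?S"
    by (meson surj_card_le finite_SigmaI finite_lessThan finite_code)
  then show ?thesis by (simp add: card_cartesian_product mult_ac)
qed

lemma in_faults_iff:
  "{to_nat (i, \<sigma>, u), to_nat (i', \<sigma>', v)} \<in> faults J \<longleftrightarrow>
    i = i' \<and> \<sigma> = \<sigma>' \<and> i < q \<and> (arc u v \<and> cut (J i \<sigma>) u v \<or> arc v u \<and> cut (J i \<sigma>) v u)"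
  (is "?e \<in> _ \<longleftrightarrow> ?rhs")
proof
  assume "?e \<in> faults J"
  then obtain l x y and \<rho> :: bool where e: "?e = {to_nat (l, \<rho>, x), to_nat (l, \<rho>, y)}"
    and l: "l < q" "arc x y" "cut (J l \<rho>) x y"
    unfolding faults_def by blast
  from e have "i = l \<and> i' = l \<and> \<sigma> = \<rho> \<and> \<sigma>' = \<rho> \<and> (u = x \<and> v = y \<or> u = y \<and> v = x)"
    by (auto simp: doubleton_eq_iff)
  with l show ?rhs by blast
next
  assume rhs: ?rhs
  then have "?e = {to_nat (i, \<sigma>, u), to_nat (i, \<sigma>, v)}" "?e = {to_nat (i, \<sigma>, v), to_nat (i, \<sigma>, u)}"
    by (simp_all add: insert_commute)
  with rhs show "?e \<in> faults J"
    unfolding faults_def mem_Collect_eq by blast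
qed

lemma potential_arc:
  assumes "chain_arc u v" "{to_nat u, to_nat v} \<notin> faults J"
    and J: "\<And>i \<sigma>. i < q \<Longrightarrow> J i \<sigma> < k ^ h"
    and "\<And>i. i < q \<Longrightarrow> {to_nat u, to_nat v} \<noteq> cross_edge i (J i False) (J i True)"
  shows "\<bar>potential J v - potential J u\<bar> \<le> 1"
  using assms(1,2,4)
proof (induction rule: chain_arc.induct)
  case (left i u v)
  then show ?case using profile_arc[of u v "J i False"] by (auto simp: in_faults_iff)
next
  case (right i u v)
  then show ?case using profile_arc[of u v "J i True"] by (auto simp: in_faults_iff)
next
  case (cross i a b)
  \<comment> \<open>The change is 3, less 2 for each end that is not the selected leaf, hence 1 or
    -1.\<close>
  then have "\<not> (a = J i False \<and> b = J i True)" by (auto simp: cross_edge_def)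
  then show ?case by (auto simp: profile_leaf)
next
  case (link i)
  then show ?case using J by (simp add: profile_root offset_def)
qed

lemma offset_diff: "offset J 4 i = offset J 2 i + 2 * int i"
  by (simp add: offset_def sum.distrib)

lemma gdist_faulty_chain_le:
  assumes W: "to_nat ` chain_box \<subseteq> W" and J: "\<And>i \<sigma>. i < q \<Longrightarrow> J i \<sigma> < k ^ h"
  shows "position J source \<le> position J sink \<and>
    gdist (del_edges (chain_graph W) (faults J)) (to_nat source) (to_nat sink)
      \<le> enat (nat (position J sink - position J source))"
proof (rule gdist_le_of_reach)
  let ?R = "\<lambda>x y. chain_arc x y \<and> {to_nat x, to_nat y} \<notin> faults J \<and> position J y = position J x + 1"
  show "to_nat source \<in> verts (del_edges (chain_graph W) (faults J))"
    using W source_in_box by (auto simp: del_edges_def chain_graph_def)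
  show "{to_nat x, to_nat y} \<in> edges (del_edges (chain_graph W) (faults J)) \<and>
      to_nat y \<in> verts (del_edges (chain_graph W) (faults J)) \<and> position J y = position J x + 1"
    if "?R x y" for x y
  proof -
    from that have "{to_nat x, to_nat y} \<in> chain_edges" unfolding chain_edges_def by blast
    with that W chain_arc_in_box[of x y] show ?thesis
      by (auto simp: del_edges_def chain_graph_def)
  qed
  have tree: "?R\<^sup>*\<^sup>* (i, False, u) (i, False, v)"
    if "i < q" "(\<lambda>u v. arc u v \<and> \<not> cut (J i False) u v)\<^sup>*\<^sup>* u v" for i u v
    using that(2)
  proof (induction rule: rtranclp_induct)
    case (step v w)
    then have "?R (i, False, v) (i, False, w)"
      using that left[of i v w] by (auto simp: in_faults_iff arc_not_cut_converse depth_arc)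
    with step show ?case by (auto intro: rtranclp.rtrancl_into_rtrancl)
  qed simp
  have cotree: "?R\<^sup>*\<^sup>* (i, True, v) (i, True, u)"
    if "i < q" "(\<lambda>u v. arc u v \<and> \<not> cut (J i True) u v)\<^sup>*\<^sup>* u v" for i u v
    using that(2)
  proof (induction rule: rtranclp_induct)
    case (step v w)
    then have "?R (i, True, w) (i, True, v)"
      using that right[of i v w] by (auto simp: in_faults_iff arc_not_cut_converse depth_arc)
    with step show ?case by (auto intro: converse_rtranclp_into_rtranclp)
  qed simp
  have copy: "?R\<^sup>*\<^sup>* (i, False, root) (i, True, root)" if i: "i < q" for i
  proof -
    have "?R (i, False, leaf (J i False)) (i, True, leaf (J i True))"
      using cross[of i "J i False" "J i True"] i J by (auto simp: in_faults_iff)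
    from rtranclp_trans[of ?R, OF rtranclp.rtrancl_into_rtrancl[of ?R,
        OF tree[OF i reach_leaf[OF J[OF i]]] this] cotree[OF i reach_leaf[OF J[OF i]]]]
    show ?thesis .
  qed
  have "?R\<^sup>*\<^sup>* source (i, True, root)" if "i < q" for i
    using that
  proof (induction i)
    case 0
    then show ?case using copy by (simp add: source_def)
  next
    case (Suc i)
    then have "?R (i, True, root) (Suc i, False, root)"
      using link[of i] by (auto simp: in_faults_iff depth_root offset_def)
    from rtranclp_trans[of ?R, OF rtranclp.rtrancl_into_rtrancl[of ?R, OF Suc.IH this]
        copy[OF Suc.prems]] Suc.prems
    show ?case by simp
  qed
  then show "?R\<^sup>*\<^sup>* source sink" using q_pos by (simp add: sink_def)
qed

lemma potential_gap:
  assumes J: "\<And>i \<sigma>. i < q \<Longrightarrow> J i \<sigma> < k ^ h"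
  shows "potential J sink - potential J source = position J sink - position J source + 2 * int q"
  using J q_pos
  by (simp add: sink_def source_def profile_root depth_root offset_diff of_nat_diff)

section \<open>Edges forced into a spanner\<close>

lemma spanner_contains_copy:
  assumes W: "to_nat ` chain_box \<subseteq> W"
    and H: "ft_additive_pairwise_spanner (2 * h * q) (2 * q - 1)
      {(to_nat source, to_nat sink)} (chain_graph W) H"
  shows "\<exists>i<q. \<forall>a<k ^ h. \<forall>b<k ^ h. cross_edge i a b \<in> edges H"
proof (rule ccontr)
  assume "\<not> ?thesis"
  \<comment> \<open>The ends of one missing cross edge per copy become the leaves that the faults
    single out.\<close>
  then obtain A B where AB:
    "\<And>i. i < q \<Longrightarrow> A i < k ^ h \<and> B i < k ^ h \<and> cross_edge i (A i) (B i) \<notin> edges H"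
    by metis
  define J where "J i \<sigma> = (if \<sigma> then B i else A i)" for i \<sigma>
  have J: "J i \<sigma> < k ^ h" if "i < q" for i \<sigma> using AB[OF that] by (simp add: J_def)
  let ?F = "faults J" and ?d = "nat (position J sink - position J source)"
  have sub: "edges H \<subseteq> chain_edges"
    using H by (auto simp: ft_additive_pairwise_spanner_def subgraph_def chain_graph_def)
  have "\<bar>potential J (from_nat y) - potential J (from_nat x)\<bar> \<le> 1"
    if "{x, y} \<in> edges (del_edges H ?F)" for x y
  proof -
    from that have xy: "{x, y} \<in> edges H" "{x, y} \<notin> ?F" by (auto simp: del_edges_def)
    with sub obtain u v where uv: "{x, y} = {to_nat u, to_nat v}" "chain_arc u v"
      by (force simp: chain_edges_def)
    have "\<bar>potential J v - potential J u\<bar> \<le> 1"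
      using xy AB J by (intro potential_arc) (auto simp: uv J_def)
    with uv(1) show ?thesis by (auto simp: doubleton_eq_iff abs_minus_commute)
  qed
  from gdist_ge_of_potential[of "del_edges H ?F" "\<lambda>x. potential J (from_nat x)", OF this]
  have "enat (nat (potential J sink - potential J source))
      \<le> gdist (del_edges H ?F) (to_nat source) (to_nat sink)"
    by (metis from_nat_to_nat)
  also have "\<dots> \<le> gdist (del_edges (chain_graph W) ?F) (to_nat source) (to_nat sink)
      + enat (2 * q - 1)"
    using H card_faults[of J] faults_subset[of J]
    by (auto simp: ft_additive_pairwise_spanner_def chain_graph_def)
  also have "\<dots> \<le> enat ?d + enat (2 * q - 1)"
    using gdist_faulty_chain_le[OF W, of J, OF J] by (intro add_right_mono) auto
  finally have "nat (potential J sink - potential J source) \<le> ?d + (2 * q - 1)" by simp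
  moreover have "position J source \<le> position J sink"
    using gdist_faulty_chain_le[OF W, of J, OF J] by blast
  \<comment> \<open>The gap is \<open>2 * q\<close>; as \<open>q > 0\<close>, the truncated
    \<open>2 * q - 1\<close> is strictly smaller.\<close>
  ultimately show False using potential_gap[of J, OF J] q_pos by linarith
qed

lemma card_edges_spanner:
  assumes W: "to_nat ` chain_box \<subseteq> W"
    and H: "ft_additive_pairwise_spanner (2 * h * q) (2 * q - 1)
      {(to_nat source, to_nat sink)} (chain_graph W) H"
  shows "k ^ (2 * h) \<le> card (edges H)"
proof -
  from spanner_contains_copy[OF assms] obtain i
    where i: "\<And>a b. a < k ^ h \<Longrightarrow> b < k ^ h \<Longrightarrow> cross_edge i a b \<in> edges H" by blast
  let ?S = "{..<k ^ h} \<times> {..<k ^ h}" and ?e = "\<lambda>(a, b). cross_edge i a b"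
  have "fin_ugraph H" using H by (auto simp: ft_additive_pairwise_spanner_def subgraph_def)
  then have "finite (edges H)"
    by (intro finite_subset[of "edges H" "Pow (verts H)"]) (auto simp: fin_ugraph_def)
  moreover have "inj_on ?e ?S"
    by (auto simp: inj_on_def cross_edge_def doubleton_eq_iff leaf_def)
  moreover have "?e ` ?S \<subseteq> edges H" using i by auto
  ultimately have "card ?S \<le> card (edges H)" by (metis card_image card_mono)
  then show ?thesis by (simp add: mult_2 power_add)
qed

lemma hard_graph_exists:
  assumes "8 * q * h * k ^ Suc h \<le> n"
  shows "\<exists>(G :: nat ugraph) s t.
      fin_ugraph G \<and> card (verts G) = n \<and> s \<in> verts G \<and> t \<in> verts G \<and>
      (\<forall>H. ft_additive_pairwise_spanner (2 * h * q) (2 * q - 1) {(s, t)} G H \<longrightarrow>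
         k ^ (2 * h) \<le> card (edges H))"
proof -
  let ?B = "to_nat ` chain_box"
  have B: "finite ?B" "card ?B = 8 * q * h * k ^ Suc h"
    using finite_chain_box card_chain_box by (auto simp: card_image inj_on_def)
  \<comment> \<open>Isolated vertices \<open>P\<close> bring the vertex count to exactly
    \<open>n\<close>.\<close>
  obtain P where P: "finite P" "card P = n - card ?B" "P \<subseteq> - ?B"
    using infinite_arbitrarily_large[of "- ?B" "n - card ?B"] B(1)
    by (metis finite_compl infinite_UNIV_nat)
  have W: "finite (?B \<union> P)" "?B \<subseteq> ?B \<union> P" using B P by auto
  have "card (?B \<union> P) = n" using B P assms by (subst card_Un_disjoint) auto
  then show ?thesis
    using fin_ugraph_chain_graph[OF W] card_edges_spanner[OF W(2)] source_in_box sink_in_box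
    by (intro exI[of _ "chain_graph (?B \<union> P)"] exI[of _ "to_nat source"] exI[of _ "to_nat sink"])
      (auto simp: chain_graph_def)
qed

end

section \<open>Choice of \<open>k\<close> for given \<open>n\<close>\<close>

lemma floor_power_lower:
  fixes N :: real and h :: nat
  assumes h: "0 < h" and N: "8 * (4 * real h) ^ Suc h \<le> N"
  obtains k :: nat where "0 < k" "8 * real k ^ Suc h \<le> N"
    "N powr (2 - 2 / (real h + 1)) \<le> 128 * real k ^ (2 * h)"
proof -
  have N0: "0 < N" using h N by (smt (verit) zero_less_power of_nat_0_less_iff)
  \<comment> \<open>Here \<open>root\<close> is the real root: \<open>x\<close> solves
    \<open>8 * x ^ Suc h = N\<close>, and the threshold on \<open>N\<close> yields
    \<open>4 * h \<le> x\<close>.\<close>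
  define x where "x = root (Suc h) (N / 8)"
  define k where "k = nat \<lfloor>x\<rfloor>"
  have x0: "0 < x" using N0 by (simp add: x_def)
  have xp: "x ^ Suc h = N / 8" unfolding x_def using N0 by (intro real_root_pow_pos2) auto
  have x: "4 * real h \<le> x"
    using N xp x0 by (intro power_le_imp_le_base[of "4 * real h" h x]) auto
  have k1: "real k \<le> x" "x - 1 \<le> real k" using x0 by (simp_all add: k_def)
  show ?thesis
  proof
    show "0 < k" using x k1 h by (cases k) auto
    have "real k ^ Suc h \<le> x ^ Suc h" using k1 by (intro power_mono) auto
    then show "8 * real k ^ Suc h \<le> N" using xp by simp
    have "x powr real (Suc h) = N / 8" using xp x0 by (simp add: powr_realpow del: power_Suc of_nat_Suc)
    then have "N = 8 * x powr (real h + 1)" by (simp add: add.commute[of 1])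
    then have "N powr (2 - 2 / (real h + 1))
        = 8 powr (2 - 2 / (real h + 1)) * x powr ((real h + 1) * (2 - 2 / (real h + 1)))"
      using x0 by (simp add: powr_mult powr_powr)
    also have "(real h + 1) * (2 - 2 / (real h + 1)) = real (2 * h)"
      by (simp add: field_simps)
    also have "x powr real (2 * h) = x ^ (2 * h)" using x0 by (rule powr_realpow)
    also have "8 powr (2 - 2 / (real h + 1)) * x ^ (2 * h) \<le> 64 * x ^ (2 * h)"
    proof (rule mult_right_mono)
      have "(8::real) powr (2 - 2 / (real h + 1)) \<le> 8 powr 2" by (intro powr_mono) auto
      then show "(8::real) powr (2 - 2 / (real h + 1)) \<le> 64" by simp
    qed (use x0 in simp)
    also have "x ^ (2 * h) \<le> 2 * real k ^ (2 * h)"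
    proof -
      \<comment> \<open>By Bernoulli, rounding \<open>x\<close> down costs at most a factor 2; with
        \<open>8 powr 2 = 64\<close> this makes 128.\<close>
      have "1 / 2 \<le> 1 + real (2 * h) * (- 1 / x)" using x x0 by (simp add: field_simps)
      also have "\<dots> \<le> (1 + (- 1 / x)) ^ (2 * h)"
        using x h x0 by (intro Bernoulli_inequality) (simp add: field_simps)
      finally have "x ^ (2 * h) * (1 / 2) \<le> x ^ (2 * h) * (1 + (- 1 / x)) ^ (2 * h)"
        using x0 by (intro mult_left_mono) auto
      also have "\<dots> = (x - 1) ^ (2 * h)"
        using x0 by (simp flip: power_mult_distrib add: algebra_simps)
      also have "\<dots> \<le> real k ^ (2 * h)" using k1 x h by (intro power_mono) auto
      finally show ?thesis by simp
    qed
    finally show "N powr (2 - 2 / (real h + 1)) \<le> 128 * real k ^ (2 * h)" by simp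
  qed
qed

theorem theorem3:
  shows "\<exists>c>0::real. \<forall>q>0::nat. \<forall>h>0::nat. \<forall>\<^sub>F n in sequentially.
    \<exists>(G :: nat ugraph) s t.
      fin_ugraph G \<and> card (verts G) = n \<and> s \<in> verts G \<and> t \<in> verts G \<and>
      (\<forall>H. ft_additive_pairwise_spanner (2 * h * q) (2 * q - 1) {(s, t)} G H \<longrightarrow>
         real (card (edges H)) \<ge> c * (real n / (real h * real q)) powr (2 - 2 / (real h + 1)))"
proof (intro exI[of _ "1 / 128"] conjI allI impI)
  fix q h :: nat assume q: "0 < q" and h: "0 < h"
  show "\<forall>\<^sub>F n in sequentially.
    \<exists>(G :: nat ugraph) s t.
      fin_ugraph G \<and> card (verts G) = n \<and> s \<in> verts G \<and> t \<in> verts G \<and>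
      (\<forall>H. ft_additive_pairwise_spanner (2 * h * q) (2 * q - 1) {(s, t)} G H \<longrightarrow>
         real (card (edges H)) \<ge> 1 / 128 * (real n / (real h * real q)) powr (2 - 2 / (real h + 1)))"
    using eventually_ge_at_top[of "h * q * (8 * (4 * h) ^ Suc h)"]
  proof eventually_elim
    case (elim n)
    then have "real (h * q * (8 * (4 * h) ^ Suc h)) \<le> real n" by (rule of_nat_mono)
    then have "8 * (4 * real h) ^ Suc h \<le> real n / (real h * real q)"
      using h q by (simp add: field_simps)
    then obtain k where k: "0 < k" "8 * real k ^ Suc h \<le> real n / (real h * real q)"
      "(real n / (real h * real q)) powr (2 - 2 / (real h + 1)) \<le> 128 * real k ^ (2 * h)"
      using floor_power_lower[OF h] by metis
    interpret chain h k q using h k(1) q by unfold_locales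
    \<comment> \<open>Multiplied by \<open>h * q\<close>, the bound on \<open>k\<close> says that
      the chain fits into \<open>n\<close> vertices.\<close>
    have "real (8 * q * h * k ^ Suc h) \<le> real n" using k(2) h q by (simp add: field_simps)
    then have "8 * q * h * k ^ Suc h \<le> n" by (rule of_nat_le_iff[THEN iffD1])
    from hard_graph_exists[OF this] obtain G :: "nat ugraph" and s t where
      G: "fin_ugraph G" "card (verts G) = n" "s \<in> verts G" "t \<in> verts G"
      "\<And>H. ft_additive_pairwise_spanner (2 * h * q) (2 * q - 1) {(s, t)} G H \<Longrightarrow>
        k ^ (2 * h) \<le> card (edges H)" by blast
    have "real (card (edges H)) \<ge> 1 / 128 * (real n / (real h * real q)) powr (2 - 2 / (real h + 1))"
      if "ft_additive_pairwise_spanner (2 * h * q) (2 * q - 1) {(s, t)} G H" for H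
    proof -
      have "real (k ^ (2 * h)) \<le> real (card (edges H))" using G(5)[OF that] by (rule of_nat_mono)
      then have "real k ^ (2 * h) \<le> real (card (edges H))" by (simp only: of_nat_power)
      with k(3) show ?thesis by linarith
    qed
    with G show ?case by blast
  qed
qed simp

end
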